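(* Let $\varepsilon\in(0,\varepsilon^*]$ and $u_0\in B_{r^*}$. Then the implicit Euler scheme $$u_n^\varepsilon=u_{n-1}^\varepsilon+\varepsilon F u_n^\varepsilon,\qquad n\in\mathbb N,\qquad u_0^\varepsilon=u_0,$$ has a unique solution $(u_n^\varepsilon)_{n\in\mathbb N}=(u_n^\varepsilon(u_0))_{n\in\mathbb N}$ with $u_n^\varepsilon(u_0)\in B_{r^*}$ for all $n\in\mathbb N$.
   Context: $\ell^2$ is the complex Hilbert space of square-summable sequences $u=(u_j)_{j\in\mathbb Z}$, $u_j\in\mathbb C$, with $(u,v)=\sum_j u_j\overline{v_j}$ and norm $\|\cdot\|$; $\|u\|_q^q=\sum_j|u_j|^q$. $\Lambda:\ell^2\to\ell^2$ is $(\Lambda u)_j=-u_{j-1}+2u_j-u_{j+1}$. Parameters: $\lambda,\gamma,k,p>0$, $\mu,\beta,\nu\in\mathbb R$, with $\gamma>4\lambda$; $g=(g_j)_{j\in\mathbb Z}$ is a fixed complex sequence with $\|g\|_{(p+2)/(p+1)}<\infty$ (hence $g\in\ell^2$). The vector field is $$Fu=(\lambda+i\mu)\Lambda u-(\gamma+i\beta)u-(k+i\nu)|u|^pu+g,\qquad |u|^pu=(|u_j|^pu_j)_{j\in\mathbb Z}.$$ $B_r=\{u\in\ell^2:\|u\|\le r\}$. $C_p>0$ is a constant depending only on $p$ such that $\||u|^pu-|v|^pv\|\le C_pr^p\|u-v\|$ for all $r>0$ and $u,v\in B_r$. For $r>0$, $M_r=(4\lambda+4|\mu|+\gamma+|\beta|)r+(k+|\nu|)r^{p+1}+\|g\|$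 and $L_r=4\lambda+4|\mu|+\gamma+|\beta|+C_pr^p(k+|\nu|)$. Fix $\eta\ge0$ and set $$c_1=\frac{p+1}{p+2}\,\frac{1}{[k(p+2)]^{1/(p+1)}}\,\|g\|_{\frac{p+2}{p+1}}^{\frac{p+2}{p+1}},\quad r^*=\sqrt{\eta+\frac{c_1}{\gamma-4\lambda}},\quad \varepsilon^*=\min\Big\{\frac1{M_{r^*+1}},\frac1{1+L_{r^*+1}}\Big\}.$$ *)

theory Defs
  imports "HOL-Analysis.Analysis"
begin

text \<open>
  Sequences indexed by the integers are functions of type \<open>int \<Rightarrow> complex\<close>; the Hilbert space
  \<open>\<ell>\<^sup>2\<close> is the set \<open>ell2\<close>.  The norms below are meaningful only for summable arguments, since
  \<open>infsum\<close> returns 0 otherwise, so membership in the space is always required separately.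
\<close>

definition ell2 :: "(int \<Rightarrow> complex) set" where
  "ell2 = {u. (\<lambda>j. (cmod (u j))\<^sup>2) summable_on UNIV}"

definition l2norm :: "(int \<Rightarrow> complex) \<Rightarrow> real" where
  "l2norm u = sqrt (\<Sum>\<^sub>\<infinity>j. (cmod (u j))\<^sup>2)"

definition ellq :: "real \<Rightarrow> (int \<Rightarrow> complex) set" where
  "ellq q = {u. (\<lambda>j. cmod (u j) powr q) summable_on UNIV}"

definition lqnorm :: "real \<Rightarrow> (int \<Rightarrow> complex) \<Rightarrow> real" where
  "lqnorm q u = (\<Sum>\<^sub>\<infinity>j. cmod (u j) powr q) powr (1 / q)"

definition Bl2 :: "real \<Rightarrow> (int \<Rightarrow> complex) set" where
  "Bl2 r = {u \<in> ell2. l2norm u \<le> r}"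

definition Lap :: "(int \<Rightarrow> complex) \<Rightarrow> int \<Rightarrow> complex" where
  "Lap u j = - u (j - 1) + 2 * u j - u (j + 1)"

definition nonlin :: "real \<Rightarrow> (int \<Rightarrow> complex) \<Rightarrow> int \<Rightarrow> complex" where
  "nonlin p u j = of_real (cmod (u j) powr p) * u j"

text \<open>The positive parameter \<open>\<lambda>\<close> is written \<open>l\<close>, as the Greek letter is reserved syntax.\<close>

definition F ::
  "real \<Rightarrow> real \<Rightarrow> real \<Rightarrow> real \<Rightarrow> real \<Rightarrow> real \<Rightarrow> real \<Rightarrow> (int \<Rightarrow> complex) \<Rightarrow>
    (int \<Rightarrow> complex) \<Rightarrow> int \<Rightarrow> complex" where
  "F l \<mu> \<gamma> \<beta> k \<nu> p g u j =
     Complex l \<mu> * Lap u j - Complex \<gamma> \<beta> * u j - Complex k \<nu> * nonlin p u j + g j"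

definition M_const ::
  "real \<Rightarrow> real \<Rightarrow> real \<Rightarrow> real \<Rightarrow> real \<Rightarrow> real \<Rightarrow> real \<Rightarrow> (int \<Rightarrow> complex) \<Rightarrow> real \<Rightarrow> real" where
  "M_const l \<mu> \<gamma> \<beta> k \<nu> p g r =
     (4 * l + 4 * \<bar>\<mu>\<bar> + \<gamma> + \<bar>\<beta>\<bar>) * r + (k + \<bar>\<nu>\<bar>) * r powr (p + 1) + l2norm g"

definition L_const ::
  "real \<Rightarrow> real \<Rightarrow> real \<Rightarrow> real \<Rightarrow> real \<Rightarrow> real \<Rightarrow> real \<Rightarrow> real \<Rightarrow> real \<Rightarrow> real" where
  "L_const l \<mu> \<gamma> \<beta> k \<nu> p C r =
     4 * l + 4 * \<bar>\<mu>\<bar> + \<gamma> + \<bar>\<beta>\<bar> + C * r powr p * (k + \<bar>\<nu>\<bar>)"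

text \<open>\<open>C\<close> is an admissible value of the Lipschitz constant \<open>C\<^sub>p\<close>.\<close>

definition is_lipschitz_const :: "real \<Rightarrow> real \<Rightarrow> bool" where
  "is_lipschitz_const p C \<longleftrightarrow> 0 < C \<and>
     (\<forall>r>0. \<forall>u\<in>Bl2 r. \<forall>v\<in>Bl2 r.
        l2norm (\<lambda>j. nonlin p u j - nonlin p v j) \<le> C * r powr p * l2norm (\<lambda>j. u j - v j))"

definition c1_const :: "real \<Rightarrow> real \<Rightarrow> (int \<Rightarrow> complex) \<Rightarrow> real" where
  "c1_const k p g =
     (p + 1) / (p + 2) * (1 / (k * (p + 2)) powr (1 / (p + 1)))
       * lqnorm ((p + 2) / (p + 1)) g powr ((p + 2) / (p + 1))"

definition r_star ::
  "real \<Rightarrow> real \<Rightarrow> real \<Rightarrow> real \<Rightarrow> (int \<Rightarrow> complex) \<Rightarrow> real \<Rightarrow> real" where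
  "r_star l \<gamma> k p g \<eta> = sqrt (\<eta> + c1_const k p g / (\<gamma> - 4 * l))"

definition eps_star ::
  "real \<Rightarrow> real \<Rightarrow> real \<Rightarrow> real \<Rightarrow> real \<Rightarrow> real \<Rightarrow> real \<Rightarrow> (int \<Rightarrow> complex) \<Rightarrow> real \<Rightarrow> real \<Rightarrow> real" where
  "eps_star l \<mu> \<gamma> \<beta> k \<nu> p g C \<eta> =
     min (1 / M_const l \<mu> \<gamma> \<beta> k \<nu> p g (r_star l \<gamma> k p g \<eta> + 1))
         (1 / (1 + L_const l \<mu> \<gamma> \<beta> k \<nu> p C (r_star l \<gamma> k p g \<eta> + 1)))"

text \<open>A solution of the implicit Euler scheme is a sequence in all of \<open>\<ell>\<^sup>2\<close>; that it stays in a
  ball is not part of the notion.\<close>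

definition euler_solution ::
  "((int \<Rightarrow> complex) \<Rightarrow> int \<Rightarrow> complex) \<Rightarrow> real \<Rightarrow> (int \<Rightarrow> complex) \<Rightarrow>
    (nat \<Rightarrow> int \<Rightarrow> complex) \<Rightarrow> bool" where
  "euler_solution f \<epsilon> u0 U \<longleftrightarrow>
     (\<forall>n. U n \<in> ell2) \<and> U 0 = u0 \<and>
     (\<forall>n\<ge>1. \<forall>j. U n j = U (n - 1) j + of_real \<epsilon> * f (U n) j)"

end

theory Submission
  imports Defs
begin

text \<open>
  One step of the scheme asks for an \<open>x\<close> in \<open>\<ell>\<^sup>2\<close> with \<open>x = w + \<epsilon> F x\<close>, where \<open>w\<close> lies in the
  ball of radius \<open>r\<^sup>*\<close>.  Two independent facts settle it.

  \<^item> \<^emph>\<open>A priori bound\<close> (\<open>implicit_step_in_ball\<close>).  Pairing the equation with \<open>x\<close> and taking real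
    parts, the Laplacian contributes at most \<open>4\<lambda>\<parallel>x\<parallel>\<^sup>2\<close>, and Young's inequality lets the damping
    \<open>-k|x|\<^sup>p x\<close> absorb the forcing up to the constant \<open>c\<^sub>1\<close>.  This yields
    \<open>(1 + 2\<epsilon>(\<gamma> - 4\<lambda>))\<parallel>x\<parallel>\<^sup>2 \<le> \<parallel>w\<parallel>\<^sup>2 + 2\<epsilon>c\<^sub>1\<close>, and \<open>r\<^sup>*\<close> is chosen so that the ball of radius \<open>r\<^sup>*\<close>
    is invariant under this inequality.  So \<^emph>\<open>every\<close> solution in \<open>\<ell>\<^sup>2\<close> is in that ball.

  \<^item> \<^emph>\<open>Contraction\<close> (\<open>implicit_step_exists\<close>, \<open>implicit_step_unique\<close>).  On the larger ball of radius
    \<open>R = r\<^sup>* + 1\<close> the field is bounded by \<open>M\<^sub>R\<close> and has Lipschitz constant \<open>L\<^sub>R\<close>.  Since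
    \<open>\<epsilon> M\<^sub>R \<le> 1\<close> and \<open>\<epsilon> L\<^sub>R < 1\<close>, the map \<open>x \<mapsto> w + \<epsilon> F x\<close> sends this ball into itself and
    contracts, so it has a unique fixed point there.

  The a priori bound makes uniqueness in the ball uniqueness in \<open>\<ell>\<^sup>2\<close>, and it returns the new
  iterate to the ball of radius \<open>r\<^sup>*\<close>, so that the step can be repeated.

  The fixed point is found coordinate by coordinate.  The Picard iterates converge in each
  coordinate, a closed ball is closed under coordinatewise limits because its defining inequality
  can be tested on finite sets of indices (\<open>mem_Bl2_iff\<close>), and \<open>F\<close> is continuous for coordinatewise
  convergence because each coordinate of \<open>F u\<close> is a continuous function of three coordinates
  of \<open>u\<close>.
\<close>

section \<open>Balls in the space of square-summable sequences\<close>

text \<open>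
  Testing on finite sets turns statements about infinite sums into statements about the finite
  Euclidean norm \<open>L2_set\<close>, where the triangle inequality applies, and keeps track of summability
  and of the norm bound at the same time.
\<close>

lemma mem_Bl2_iff:
  assumes "0 \<le> r"
  shows "u \<in> Bl2 r \<longleftrightarrow> (\<forall>A. finite A \<longrightarrow> L2_set (\<lambda>j. cmod (u j)) A \<le> r)"
proof
  assume u: "u \<in> Bl2 r"
  then have s: "(\<lambda>j. (cmod (u j))\<^sup>2) summable_on UNIV"
    and b: "sqrt (\<Sum>\<^sub>\<infinity>j. (cmod (u j))\<^sup>2) \<le> r"
    by (auto simp: Bl2_def ell2_def l2norm_def)
  show "\<forall>A. finite A \<longrightarrow> L2_set (\<lambda>j. cmod (u j)) A \<le> r"
  proof (intro allI impI)
    fix A :: "int set" assume "finite A"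
    then have "(\<Sum>j\<in>A. (cmod (u j))\<^sup>2) \<le> (\<Sum>\<^sub>\<infinity>j. (cmod (u j))\<^sup>2)"
      by (intro finite_sum_le_infsum s) auto
    then show "L2_set (\<lambda>j. cmod (u j)) A \<le> r"
      unfolding L2_set_def using b by (meson order_trans real_sqrt_le_mono)
  qed
next
  assume "\<forall>A. finite A \<longrightarrow> L2_set (\<lambda>j. cmod (u j)) A \<le> r"
  then have *: "(\<Sum>j\<in>A. (cmod (u j))\<^sup>2) \<le> r\<^sup>2" if "finite A" for A
    using that unfolding L2_set_def by (simp add: sqrt_le_D)
  have s: "(\<lambda>j. (cmod (u j))\<^sup>2) summable_on UNIV"
    by (rule nonneg_bdd_above_summable_on) (auto intro!: bdd_aboveI2 *)
  moreover have "(\<Sum>\<^sub>\<infinity>j. (cmod (u j))\<^sup>2) \<le> r\<^sup>2"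
    by (rule infsum_le_finite_sums[OF s]) (rule *)
  then have "l2norm u \<le> r"
    unfolding l2norm_def using assms by (simp add: real_le_lsqrt)
  ultimately show "u \<in> Bl2 r"
    by (simp add: Bl2_def ell2_def)
qed

lemma l2norm_nonneg: "0 \<le> l2norm u"
  by (simp add: l2norm_def infsum_nonneg)

lemma Bl2_radius_nonneg: "u \<in> Bl2 r \<Longrightarrow> 0 \<le> r"
  using l2norm_nonneg[of u] by (auto simp: Bl2_def)

lemma Bl2_imp_ell2: "u \<in> Bl2 r \<Longrightarrow> u \<in> ell2"
  by (simp add: Bl2_def)

lemma ell2_in_Bl2: "u \<in> ell2 \<Longrightarrow> u \<in> Bl2 (l2norm u)"
  by (simp add: Bl2_def)

lemma Bl2_mono: "u \<in> Bl2 r \<Longrightarrow> r \<le> s \<Longrightarrow> u \<in> Bl2 s"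
  by (simp add: Bl2_def)

lemma Bl2_cmod_le:
  assumes "u \<in> Bl2 r"
  shows "cmod (u j) \<le> r"
  using assms mem_Bl2_iff[OF Bl2_radius_nonneg[OF assms]]
  by (auto dest!: spec[of _ "{j}"])

lemma Bl2_add:
  assumes "u \<in> Bl2 r" "v \<in> Bl2 s"
  shows "(\<lambda>j. u j + v j) \<in> Bl2 (r + s)"
proof -
  note nn = Bl2_radius_nonneg[OF assms(1)] Bl2_radius_nonneg[OF assms(2)]
  have "L2_set (\<lambda>j. cmod (u j + v j)) A \<le> r + s" if "finite A" for A
  proof -
    have "L2_set (\<lambda>j. cmod (u j + v j)) A \<le> L2_set (\<lambda>j. cmod (u j) + cmod (v j)) A"
      by (intro L2_set_mono norm_triangle_ineq norm_ge_zero)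
    also have "\<dots> \<le> L2_set (\<lambda>j. cmod (u j)) A + L2_set (\<lambda>j. cmod (v j)) A"
      by (rule L2_set_triangle_ineq)
    also have "\<dots> \<le> r + s"
      using assms that nn by (intro add_mono) (auto simp: mem_Bl2_iff)
    finally show ?thesis .
  qed
  then show ?thesis
    using nn by (simp add: mem_Bl2_iff)
qed

lemma Bl2_pointwise_bound:
  assumes "u \<in> Bl2 r" "0 \<le> b" "\<And>j. cmod (v j) \<le> b * cmod (u j)"
  shows "v \<in> Bl2 (b * r)"
proof -
  note nn = Bl2_radius_nonneg[OF assms(1)]
  have "L2_set (\<lambda>j. cmod (v j)) A \<le> b * r" if "finite A" for A
  proof -
    have "L2_set (\<lambda>j. cmod (v j)) A \<le> L2_set (\<lambda>j. b * cmod (u j)) A"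
      by (intro L2_set_mono assms(3) norm_ge_zero)
    also have "\<dots> = b * L2_set (\<lambda>j. cmod (u j)) A"
      by (simp add: L2_set_right_distrib assms(2))
    also have "\<dots> \<le> b * r"
      using assms(1,2) that nn by (intro mult_left_mono) (auto simp: mem_Bl2_iff)
    finally show ?thesis .
  qed
  then show ?thesis
    using nn assms(2) by (simp add: mem_Bl2_iff)
qed

lemma Bl2_scale:
  assumes "u \<in> Bl2 r" "cmod c \<le> b"
  shows "(\<lambda>j. c * u j) \<in> Bl2 (b * r)"
  using order_trans[OF norm_ge_zero assms(2)] assms(2)
  by (intro Bl2_pointwise_bound[OF assms(1)]) (auto simp: norm_mult mult_right_mono)

lemma Bl2_diff:
  assumes "u \<in> Bl2 r" "v \<in> Bl2 s"
  shows "(\<lambda>j. u j - v j) \<in> Bl2 (r + s)"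
  using Bl2_add[OF assms(1) Bl2_scale[OF assms(2), of "-1" 1]] by simp

lemma Bl2_shift:
  assumes "u \<in> Bl2 r"
  shows "(\<lambda>j. u (j + m)) \<in> Bl2 r"
proof -
  have bij: "bij_betw (\<lambda>j::int. j + m) UNIV UNIV"
    by (intro bij_betwI[where g = "\<lambda>j. j - m"]) auto
  show ?thesis
    using assms summable_on_reindex_bij_betw[OF bij, of "\<lambda>j. (cmod (u j))\<^sup>2"]
      infsum_reindex_bij_betw[OF bij, of "\<lambda>j. (cmod (u j))\<^sup>2"]
    by (simp add: Bl2_def ell2_def l2norm_def)
qed

text \<open>Fatou's lemma for counting measure; on a finite index set the limit is a plain limit.\<close>

lemma Bl2_pointwise_limit:
  assumes "\<And>n. X n \<in> Bl2 r" "\<And>j. (\<lambda>n. X n j) \<longlonglongrightarrow> x j"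
  shows "x \<in> Bl2 r"
proof -
  note nn = Bl2_radius_nonneg[OF assms(1)]
  have "L2_set (\<lambda>j. cmod (x j)) A \<le> r" if "finite A" for A
  proof (rule LIMSEQ_le_const2)
    show "(\<lambda>n. L2_set (\<lambda>j. cmod (X n j)) A) \<longlonglongrightarrow> L2_set (\<lambda>j. cmod (x j)) A"
      unfolding L2_set_def by (intro tendsto_intros assms)
    show "\<exists>N. \<forall>n\<ge>N. L2_set (\<lambda>j. cmod (X n j)) A \<le> r"
      using assms(1) that nn by (auto simp: mem_Bl2_iff)
  qed
  then show ?thesis
    using nn by (simp add: mem_Bl2_iff)
qed

section \<open>A contraction principle with coordinatewise continuity\<close>

text \<open>
  The contraction hypothesis is phrased with arbitrary bounds \<open>d\<close> on the difference instead of
  its norm.  In this form it carries summability of the difference of the images, and its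
  conclusion is again of the shape of its last premise, so that it iterates.
\<close>

lemma Bl2_contraction_fixed_point:
  fixes G :: "(int \<Rightarrow> complex) \<Rightarrow> int \<Rightarrow> complex"
  assumes "0 \<le> R" "0 \<le> q" "q < 1"
    and maps: "\<And>u. u \<in> Bl2 R \<Longrightarrow> G u \<in> Bl2 R"
    and lip: "\<And>u v d. \<lbrakk>u \<in> Bl2 R; v \<in> Bl2 R; (\<lambda>j. u j - v j) \<in> Bl2 d\<rbrakk>
      \<Longrightarrow> (\<lambda>j. G u j - G v j) \<in> Bl2 (q * d)"
    and cont: "\<And>X x j. (\<And>i. (\<lambda>n. X n i) \<longlonglongrightarrow> x i) \<Longrightarrow> (\<lambda>n. G (X n) j) \<longlonglongrightarrow> G x j"
  shows "\<exists>x\<in>Bl2 R. G x = x"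
proof -
  define X where "X n = (G ^^ n) (\<lambda>_. 0)" for n
  have X_Suc: "X (Suc n) = G (X n)" for n
    by (simp add: X_def)
  have "X 0 \<in> Bl2 R"
    using assms(1) by (simp add: X_def mem_Bl2_iff L2_set_def)
  then have XB: "X n \<in> Bl2 R" for n
    by (induction n) (auto simp: X_Suc maps)
  have step: "(\<lambda>j. X (Suc n) j - X n j) \<in> Bl2 (q ^ n * R)" for n
  proof (induction n)
    case 0
    have "X 0 = (\<lambda>_. 0)"
      by (simp add: X_def)
    then show ?case
      using XB[of "Suc 0"] by simp
  next
    case (Suc n)
    then have "(\<lambda>j. G (X (Suc n)) j - G (X n) j) \<in> Bl2 (q * (q ^ n * R))"
      by (intro lip XB)
    then show ?case
      by (simp add: X_Suc mult.assoc)
  qed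
  have "convergent (\<lambda>n. X n j)" for j
  proof -
    have "summable (\<lambda>n. X (Suc n) j - X n j)"
    proof (rule summable_comparison_test)
      show "\<exists>N. \<forall>n\<ge>N. norm (X (Suc n) j - X n j) \<le> q ^ n * R"
        using Bl2_cmod_le[OF step] by auto
      show "summable (\<lambda>n. q ^ n * R)"
        using assms(2,3) by (intro summable_mult2 summable_geometric) auto
    qed
    then have "convergent (\<lambda>n. \<Sum>i<n. X (Suc i) j - X i j)"
      by (simp add: summable_iff_convergent)
    moreover have "(\<Sum>i<n. X (Suc i) j - X i j) = X n j - X 0 j" for n
      using sum_lessThan_telescope[of "\<lambda>i. X i j" n] by simp
    ultimately have "convergent (\<lambda>n. X n j - X 0 j)"
      by simp
    then show ?thesis
      using convergent_diff_const_right_iff[of "\<lambda>n. X n j" "X 0 j"] by simp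
  qed
  then have "\<exists>x. \<forall>j. (\<lambda>n. X n j) \<longlonglongrightarrow> x j"
    unfolding convergent_def by metis
  then obtain x where x: "\<And>j. (\<lambda>n. X n j) \<longlonglongrightarrow> x j"
    by blast
  have "G x j = x j" for j
  proof (rule LIMSEQ_unique)
    show "(\<lambda>n. G (X n) j) \<longlonglongrightarrow> G x j"
      by (rule cont) (rule x)
    show "(\<lambda>n. G (X n) j) \<longlonglongrightarrow> x j"
      using LIMSEQ_Suc[OF x[of j]] by (simp add: X_Suc)
  qed
  moreover have "x \<in> Bl2 R"
    using XB x by (rule Bl2_pointwise_limit)
  ultimately show ?thesis
    by blast
qed

lemma Bl2_contraction_fixed_point_unique:
  fixes G :: "(int \<Rightarrow> complex) \<Rightarrow> int \<Rightarrow> complex"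
  assumes "q < 1"
    and lip: "\<And>u v d. \<lbrakk>u \<in> Bl2 R; v \<in> Bl2 R; (\<lambda>j. u j - v j) \<in> Bl2 d\<rbrakk>
      \<Longrightarrow> (\<lambda>j. G u j - G v j) \<in> Bl2 (q * d)"
    and x: "x \<in> Bl2 R" "G x = x" and y: "y \<in> Bl2 R" "G y = y"
  shows "x = y"
proof -
  define d where "d = l2norm (\<lambda>j. x j - y j)"
  have d: "(\<lambda>j. x j - y j) \<in> Bl2 d"
    unfolding d_def by (intro ell2_in_Bl2 Bl2_imp_ell2[OF Bl2_diff[OF x(1) y(1)]])
  have "(\<lambda>j. x j - y j) \<in> Bl2 (q * d)"
    using lip[OF x(1) y(1) d] by (simp add: x y)
  then have "d \<le> q * d"
    by (simp add: Bl2_def d_def)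
  then have "(1 - q) * d \<le> 0"
    by (simp add: algebra_simps)
  then have "d \<le> 0"
    using assms(1) by (simp add: mult_le_0_iff)
  then have "cmod (x j - y j) \<le> 0" for j
    using Bl2_cmod_le[OF d] order_trans by blast
  then show ?thesis
    by auto
qed

section \<open>Boundedness, Lipschitz continuity and continuity of the vector field\<close>

text \<open>
  The exponent \<open>(p + 2)/(p + 1)\<close> is less than \<open>2\<close>, and smaller exponents give smaller sequence
  spaces: a summable sequence is bounded, so the excess power can be estimated by a constant.
\<close>

lemma ellq_subset_ell2:
  assumes "0 < q" "q \<le> 2"
  shows "ellq q \<subseteq> ell2"
proof
  fix g assume "g \<in> ellq q"
  then have s: "(\<lambda>j. cmod (g j) powr q) summable_on UNIV"
    by (simp add: ellq_def)
  define S where "S = (\<Sum>\<^sub>\<infinity>j. cmod (g j) powr q)"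
  have le: "cmod (g j) powr q \<le> S" for j
    using finite_sum_le_infsum[OF s, of "{j}"] by (simp add: S_def)
  have "(cmod (g j))\<^sup>2 \<le> S powr ((2 - q) / q) * cmod (g j) powr q" for j
  proof -
    have "(cmod (g j))\<^sup>2 = cmod (g j) powr 2"
      by (cases "g j = 0") (auto simp: powr_numeral)
    also have "\<dots> = (cmod (g j) powr q) powr ((2 - q) / q) * cmod (g j) powr q"
      using assms by (simp add: powr_powr flip: powr_add)
    also have "\<dots> \<le> S powr ((2 - q) / q) * cmod (g j) powr q"
      using assms by (intro mult_right_mono powr_mono2 le) auto
    finally show ?thesis .
  qed
  then have "(\<lambda>j. (cmod (g j))\<^sup>2) summable_on UNIV"
    by (intro summable_on_comparison_test[OF summable_on_cmult_right[OF s]]) auto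
  then show "g \<in> ell2"
    by (simp add: ell2_def)
qed

lemma nonlin_in_Bl2:
  assumes "u \<in> Bl2 r" "0 < p"
  shows "nonlin p u \<in> Bl2 (r powr (p + 1))"
proof -
  have "nonlin p u \<in> Bl2 (r powr p * r)"
  proof (rule Bl2_pointwise_bound[OF assms(1)])
    fix j
    have "cmod (u j) powr p \<le> r powr p"
      using assms Bl2_cmod_le[OF assms(1)] by (intro powr_mono2) auto
    then show "cmod (nonlin p u j) \<le> r powr p * cmod (u j)"
      by (simp add: nonlin_def norm_mult mult_right_mono)
  qed simp
  then show ?thesis
    using Bl2_radius_nonneg[OF assms(1)] by (simp add: powr_add)
qed

lemma nonlin_diff_in_Bl2:
  assumes C: "is_lipschitz_const p C" and "0 < p" "0 < r"
    and u: "u \<in> Bl2 r" and v: "v \<in> Bl2 r" and d: "(\<lambda>j. u j - v j) \<in> Bl2 d"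
  shows "(\<lambda>j. nonlin p u j - nonlin p v j) \<in> Bl2 (C * r powr p * d)"
proof -
  have "l2norm (\<lambda>j. nonlin p u j - nonlin p v j) \<le> C * r powr p * l2norm (\<lambda>j. u j - v j)"
    using C u v assms(3) by (auto simp: is_lipschitz_const_def)
  also have "\<dots> \<le> C * r powr p * d"
    using C d by (intro mult_left_mono) (auto simp: is_lipschitz_const_def Bl2_def)
  finally show ?thesis
    using Bl2_imp_ell2[OF Bl2_diff[OF nonlin_in_Bl2[OF u assms(2)] nonlin_in_Bl2[OF v assms(2)]]]
    by (simp add: Bl2_def)
qed

lemma Lap_in_Bl2:
  assumes "u \<in> Bl2 r"
  shows "Lap u \<in> Bl2 (4 * r)"
proof -
  have "(\<lambda>j. 2 * u j - u (j + - 1) - u (j + 1)) \<in> Bl2 (2 * r + r + r)"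
    by (intro Bl2_diff Bl2_scale Bl2_shift assms) simp
  moreover have "Lap u = (\<lambda>j. 2 * u j - u (j + - 1) - u (j + 1))"
    by (auto simp: Lap_def)
  ultimately show ?thesis
    by simp
qed

text \<open>
  The estimate behind both \<open>M_const\<close> and \<open>L_const\<close>; the nonlinear part enters only through the
  bound \<open>s\<close>, which is a power of the radius for the former and linear in the distance for the
  latter.
\<close>

lemma linear_part_in_Bl2:
  assumes "0 < l" "0 < \<gamma>" "0 < k" "u \<in> Bl2 r" "v \<in> Bl2 s"
  shows "(\<lambda>j. Complex l \<mu> * Lap u j - Complex \<gamma> \<beta> * u j - Complex k \<nu> * v j)
    \<in> Bl2 ((4 * l + 4 * \<bar>\<mu>\<bar> + \<gamma> + \<bar>\<beta>\<bar>) * r + (k + \<bar>\<nu>\<bar>) * s)"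
proof -
  have c: "cmod (Complex a b) \<le> a + \<bar>b\<bar>" if "0 < a" for a b
    using cmod_le[of "Complex a b"] that by simp
  have "(\<lambda>j. Complex l \<mu> * Lap u j - Complex \<gamma> \<beta> * u j - Complex k \<nu> * v j)
    \<in> Bl2 ((l + \<bar>\<mu>\<bar>) * (4 * r) + (\<gamma> + \<bar>\<beta>\<bar>) * r + (k + \<bar>\<nu>\<bar>) * s)"
    using assms by (intro Bl2_diff Bl2_scale Lap_in_Bl2 c)
  then show ?thesis
    by (simp add: algebra_simps)
qed

lemma F_in_Bl2:
  assumes "0 < l" "0 < \<gamma>" "0 < k" "0 < p" "g \<in> ell2" "u \<in> Bl2 r"
  shows "F l \<mu> \<gamma> \<beta> k \<nu> p g u \<in> Bl2 (M_const l \<mu> \<gamma> \<beta> k \<nu> p g r)"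
  using Bl2_add[OF linear_part_in_Bl2[OF assms(1-3) assms(6) nonlin_in_Bl2[OF assms(6,4)]]
      ell2_in_Bl2[OF assms(5)], of \<mu> \<beta> \<nu>]
  unfolding M_const_def F_def .

lemma F_diff_in_Bl2:
  assumes "0 < l" "0 < \<gamma>" "0 < k" "0 < p" "is_lipschitz_const p C" "0 < r"
    and "u \<in> Bl2 r" "v \<in> Bl2 r" "(\<lambda>j. u j - v j) \<in> Bl2 d"
  shows "(\<lambda>j. F l \<mu> \<gamma> \<beta> k \<nu> p g u j - F l \<mu> \<gamma> \<beta> k \<nu> p g v j)
    \<in> Bl2 (L_const l \<mu> \<gamma> \<beta> k \<nu> p C r * d)"
proof -
  have "(\<lambda>j. F l \<mu> \<gamma> \<beta> k \<nu> p g u j - F l \<mu> \<gamma> \<beta> k \<nu> p g v j)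
    = (\<lambda>j. Complex l \<mu> * Lap (\<lambda>j. u j - v j) j - Complex \<gamma> \<beta> * (u j - v j)
        - Complex k \<nu> * (nonlin p u j - nonlin p v j))"
    by (auto simp: F_def Lap_def algebra_simps)
  also have "\<dots> \<in> Bl2 ((4 * l + 4 * \<bar>\<mu>\<bar> + \<gamma> + \<bar>\<beta>\<bar>) * d + (k + \<bar>\<nu>\<bar>) * (C * r powr p * d))"
    by (intro linear_part_in_Bl2 nonlin_diff_in_Bl2 assms)
  also have "(4 * l + 4 * \<bar>\<mu>\<bar> + \<gamma> + \<bar>\<beta>\<bar>) * d + (k + \<bar>\<nu>\<bar>) * (C * r powr p * d)
    = L_const l \<mu> \<gamma> \<beta> k \<nu> p C r * d"
    by (simp add: L_const_def algebra_simps)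
  finally show ?thesis .
qed

lemma F_pointwise_continuous:
  assumes "0 < p" "\<And>i. (\<lambda>n. X n i) \<longlonglongrightarrow> x i"
  shows "(\<lambda>n. F l \<mu> \<gamma> \<beta> k \<nu> p g (X n) j) \<longlonglongrightarrow> F l \<mu> \<gamma> \<beta> k \<nu> p g x j"
  unfolding F_def Lap_def nonlin_def
  by (intro tendsto_intros assms) (use assms(1) in auto)

section \<open>The energy estimate\<close>

text \<open>
  Young's inequality with the conjugate exponents \<open>p + 2\<close> and \<open>(p + 2)/(p + 1)\<close>, weighted so that
  the power of \<open>a\<close> comes out with coefficient exactly \<open>k\<close>; this is what fixes the
  constant in \<open>c1_const\<close>.
\<close>

lemma Young_weighted:
  fixes a b k p :: real
  assumes "0 < k" "0 < p" "0 \<le> a" "0 \<le> b"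
  shows "a * b \<le> k * a powr (p + 2)
    + (p + 1) / (p + 2) * (1 / (k * (p + 2)) powr (1 / (p + 1))) * b powr ((p + 2) / (p + 1))"
proof -
  \<comment> \<open>the weight for which \<open>(s a)\<^bsup>p+2\<^esup>/(p + 2)\<close> equals \<open>k a\<^bsup>p+2\<^esup>\<close>\<close>
  define s where "s = (k * (p + 2)) powr (1 / (p + 2))"
  have s: "0 < s"
    using assms by (simp add: s_def)
  have s1: "s powr (p + 2) = k * (p + 2)"
    using assms by (simp add: s_def powr_powr)
  have s2: "s powr ((p + 2) / (p + 1)) = (k * (p + 2)) powr (1 / (p + 1))"
    using assms by (simp add: s_def powr_powr)
  have "a * b = (s * a) * (b / s)"
    using s by simp
  also have "\<dots> \<le> (s * a) powr (p + 2) / (p + 2)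
      + (b / s) powr ((p + 2) / (p + 1)) / ((p + 2) / (p + 1))"
    using assms s by (intro Youngs_inequality) (auto simp: field_simps)
  also have "(s * a) powr (p + 2) / (p + 2) = k * a powr (p + 2)"
    using assms s by (simp add: powr_mult s1)
  also have "(b / s) powr ((p + 2) / (p + 1)) / ((p + 2) / (p + 1))
    = (p + 1) / (p + 2) * (1 / (k * (p + 2)) powr (1 / (p + 1))) * b powr ((p + 2) / (p + 1))"
    using assms s by (simp add: powr_divide s2 mult_ac)
  finally show ?thesis .
qed

text \<open>
  The local energy balance.  The imaginary coefficient \<open>\<mu>\<close> only produces a discrete flux
  difference, which telescopes when summed over all \<open>j\<close>; neighbouring values are
  separated with \<open>-2 Re (a cnj b) \<le> |a|\<^sup>2 + |b|\<^sup>2\<close>.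
\<close>

lemma Re_F_cnj_le:
  fixes x g :: "int \<Rightarrow> complex"
  assumes "0 < l" "0 < k" "0 < p"
  shows "Re (F l \<mu> \<gamma> \<beta> k \<nu> p g x j * cnj (x j))
    \<le> l * (3 * (cmod (x j))\<^sup>2 + ((cmod (x (j - 1)))\<^sup>2 + (cmod (x (j + 1)))\<^sup>2) / 2)
      - \<mu> * (Im (x j * cnj (x (j + 1))) - Im (x (j - 1) * cnj (x j)))
      - \<gamma> * (cmod (x j))\<^sup>2
      + (p + 1) / (p + 2) * (1 / (k * (p + 2)) powr (1 / (p + 1)))
          * cmod (g j) powr ((p + 2) / (p + 1))"
proof -
  have cross: "- Re (a * cnj b) \<le> ((cmod a)\<^sup>2 + (cmod b)\<^sup>2) / 2" for a b
    using zero_le_power2[of "Re a + Re b"] zero_le_power2[of "Im a + Im b"]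
    unfolding cmod_power2 by (simp add: power2_eq_square algebra_simps)
  have lap: "Re (Lap x j * cnj (x j))
      \<le> 3 * (cmod (x j))\<^sup>2 + ((cmod (x (j - 1)))\<^sup>2 + (cmod (x (j + 1)))\<^sup>2) / 2"
  proof -
    have "Re (Lap x j * cnj (x j))
        = 2 * (cmod (x j))\<^sup>2 - Re (x (j - 1) * cnj (x j)) - Re (x (j + 1) * cnj (x j))"
      unfolding cmod_power2 by (simp add: Lap_def power2_eq_square algebra_simps)
    also have "\<dots> = 2 * (cmod (x j))\<^sup>2 + - Re (x (j - 1) * cnj (x j))
        + - Re (x (j + 1) * cnj (x j))"
      by (simp only: diff_conv_add_uminus)
    also have "\<dots> \<le> 2 * (cmod (x j))\<^sup>2 + ((cmod (x (j - 1)))\<^sup>2 + (cmod (x j))\<^sup>2) / 2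
        + ((cmod (x (j + 1)))\<^sup>2 + (cmod (x j))\<^sup>2) / 2"
      by (intro add_mono cross order_refl)
    finally show ?thesis
      by (simp add: field_simps)
  qed
  have flux: "Im (Lap x j * cnj (x j)) = Im (x j * cnj (x (j + 1))) - Im (x (j - 1) * cnj (x j))"
    by (simp add: Lap_def algebra_simps)
  have "Re (F l \<mu> \<gamma> \<beta> k \<nu> p g x j * cnj (x j))
      = l * Re (Lap x j * cnj (x j)) - \<mu> * Im (Lap x j * cnj (x j)) - \<gamma> * (cmod (x j))\<^sup>2
        - k * (cmod (x j) powr p * (cmod (x j))\<^sup>2) + Re (g j * cnj (x j))"
    unfolding cmod_power2 by (simp add: F_def nonlin_def power2_eq_square algebra_simps)
  also have "cmod (x j) powr p * (cmod (x j))\<^sup>2 = cmod (x j) powr (p + 2)"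
    by (cases "x j = 0") (auto simp: powr_add powr_numeral)
  finally have eq: "Re (F l \<mu> \<gamma> \<beta> k \<nu> p g x j * cnj (x j))
      = l * Re (Lap x j * cnj (x j)) - \<mu> * Im (Lap x j * cnj (x j)) - \<gamma> * (cmod (x j))\<^sup>2
        - k * cmod (x j) powr (p + 2) + Re (g j * cnj (x j))" .
  have "Re (g j * cnj (x j)) \<le> cmod (x j) * cmod (g j)"
    using complex_Re_le_cmod[of "g j * cnj (x j)"] by (simp add: norm_mult mult.commute)
  also have "\<dots> \<le> k * cmod (x j) powr (p + 2) + (p + 1) / (p + 2)
      * (1 / (k * (p + 2)) powr (1 / (p + 1))) * cmod (g j) powr ((p + 2) / (p + 1))"
    using assms by (intro Young_weighted) auto
  finally show ?thesis
    using mult_left_mono[OF lap, of l] assms unfolding eq flux by linarith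
qed

text \<open>
  By shift invariance of sums over the integers, the neighbour terms of the local balance
  contribute another \<open>\<lambda>\<parallel>x\<parallel>\<^sup>2\<close>, which makes \<open>4\<lambda>\<parallel>x\<parallel>\<^sup>2\<close> in total, and the flux differences
  cancel.  The factor 2 comes from splitting \<open>Re (w, x)\<close> as \<open>(\<parallel>w\<parallel>\<^sup>2 + \<parallel>x\<parallel>\<^sup>2)/2\<close> and absorbing
  half of \<open>\<parallel>x\<parallel>\<^sup>2\<close> on the left.
\<close>

lemma implicit_step_energy:
  fixes x w g :: "int \<Rightarrow> complex"
  assumes pos: "0 < l" "0 < k" "0 < p" "0 < \<epsilon>"
    and g: "g \<in> ellq ((p + 2) / (p + 1))"
    and x: "x \<in> ell2" and w: "w \<in> ell2"
    and eq: "\<And>j. x j = w j + of_real \<epsilon> * F l \<mu> \<gamma> \<beta> k \<nu> p g x j"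
  shows "(1 + 2 * \<epsilon> * (\<gamma> - 4 * l)) * (l2norm x)\<^sup>2 \<le> (l2norm w)\<^sup>2 + 2 * \<epsilon> * c1_const k p g"
proof -
  define X where "X j = (cmod (x j))\<^sup>2" for j
  define W where "W j = (cmod (w j))\<^sup>2" for j
  define q where "q = (p + 2) / (p + 1)"
  define D where "D = (p + 1) / (p + 2) * (1 / (k * (p + 2)) powr (1 / (p + 1)))"
  define flux where "flux j = Im (x (j - 1) * cnj (x j))" for j
  have shift: "((\<lambda>j. f (j + m)) has_sum S) UNIV" if "(f has_sum S) UNIV"
    for f :: "int \<Rightarrow> real" and m S
    using that by (subst has_sum_reindex_bij_betw)
      (auto intro!: bij_betwI[where g = "\<lambda>j. j - m"])
  have hsq: "((\<lambda>j. (cmod (u j))\<^sup>2) has_sum (l2norm u)\<^sup>2) UNIV" if "u \<in> ell2" for u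
    using that by (auto simp: ell2_def l2norm_def infsum_nonneg)
  have hX: "(X has_sum (l2norm x)\<^sup>2) UNIV" and hW: "(W has_sum (l2norm w)\<^sup>2) UNIV"
    using hsq[OF x] hsq[OF w] by (auto simp: X_def[abs_def] W_def[abs_def])
  have hg: "((\<lambda>j. D * cmod (g j) powr q) has_sum c1_const k p g) UNIV"
  proof -
    have q: "0 < q"
      using pos by (simp add: q_def)
    have "((\<lambda>j. cmod (g j) powr q) has_sum (\<Sum>\<^sub>\<infinity>j. cmod (g j) powr q)) UNIV"
      using g by (simp add: ellq_def q_def)
    also have "(\<Sum>\<^sub>\<infinity>j. cmod (g j) powr q) = lqnorm q g powr q"
      using q by (simp add: lqnorm_def powr_powr infsum_nonneg)
    finally show ?thesis
      unfolding c1_const_def by (fold q_def D_def) (rule has_sum_cmult_right)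
  qed
  have "flux summable_on UNIV"
  proof (rule abs_summable_summable)
    have "(\<lambda>j. X (j + - 1) + X j) summable_on UNIV"
      using has_sum_add[OF shift[OF hX, of "- 1"] hX] by (auto simp: summable_on_def)
    then show "(\<lambda>j. norm (flux j)) summable_on UNIV"
    proof (rule summable_on_comparison_test)
      fix j
      have "norm (flux j) \<le> cmod (x (j - 1)) * cmod (x j)"
        using abs_Im_le_cmod[of "x (j - 1) * cnj (x j)"] by (simp add: flux_def norm_mult)
      also have "\<dots> \<le> 2 * cmod (x (j - 1)) * cmod (x j)"
        by simp
      also have "\<dots> \<le> X (j + - 1) + X j"
        using sum_squares_bound[of "cmod (x (j - 1))" "cmod (x j)"] by (simp add: X_def)
      finally show "norm (flux j) \<le> X (j + - 1) + X j" .
    qed simp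
  qed
  then obtain S where hS: "(flux has_sum S) UNIV"
    by (auto simp: summable_on_def)
  \<comment> \<open>differences are written as sums with scalar factors so that the sum of \<open>rhs\<close> is read off
    from linearity alone\<close>
  define rhs where "rhs j = 1 / 2 * (W j + X j) + \<epsilon> * (l * (3 * X j + 1 / 2 * (X (j + - 1) + X (j + 1)))
      + (- \<mu>) * (flux (j + 1) + (- 1) * flux j) + (- \<gamma>) * X j + D * cmod (g j) powr q)" for j
  have "(rhs has_sum (1 / 2 * ((l2norm w)\<^sup>2 + (l2norm x)\<^sup>2)
      + \<epsilon> * (l * (3 * (l2norm x)\<^sup>2 + 1 / 2 * ((l2norm x)\<^sup>2 + (l2norm x)\<^sup>2))
        + (- \<mu>) * (S + (- 1) * S) + (- \<gamma>) * (l2norm x)\<^sup>2 + c1_const k p g))) UNIV"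
    unfolding rhs_def[abs_def]
    by (intro has_sum_add has_sum_cmult_right hX hW hg hS shift[OF hS] shift[OF hX])
  moreover have "X j \<le> rhs j" for j
  proof -
    have "X j = Re (x j * cnj (x j))"
      unfolding X_def cmod_power2 by (simp add: power2_eq_square)
    also have "\<dots> = Re ((w j + of_real \<epsilon> * F l \<mu> \<gamma> \<beta> k \<nu> p g x j) * cnj (x j))"
      using eq[of j] by simp
    also have "\<dots> = Re (w j * cnj (x j)) + \<epsilon> * Re (F l \<mu> \<gamma> \<beta> k \<nu> p g x j * cnj (x j))"
      by (simp add: algebra_simps)
    also have "\<dots> \<le> rhs j"
      unfolding rhs_def
    proof (intro add_mono mult_left_mono)
      show "Re (w j * cnj (x j)) \<le> 1 / 2 * (W j + X j)"
        using zero_le_power2[of "Re (w j) - Re (x j)"] zero_le_power2[of "Im (w j) - Im (x j)"]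
        unfolding W_def X_def cmod_power2 by (simp add: power2_eq_square algebra_simps)
      show "Re (F l \<mu> \<gamma> \<beta> k \<nu> p g x j * cnj (x j))
        \<le> l * (3 * X j + 1 / 2 * (X (j + - 1) + X (j + 1))) + - \<mu> * (flux (j + 1) + - 1 * flux j)
          + - \<gamma> * X j + D * cmod (g j) powr q"
        using Re_F_cnj_le[OF pos(1-3), of \<mu> \<gamma> \<beta> \<nu> g x j]
        by (simp add: X_def flux_def D_def q_def algebra_simps add_divide_distrib)
    qed (use pos in auto)
    finally show ?thesis .
  qed
  ultimately have "(l2norm x)\<^sup>2 \<le> 1 / 2 * ((l2norm w)\<^sup>2 + (l2norm x)\<^sup>2)
      + \<epsilon> * (l * (3 * (l2norm x)\<^sup>2 + 1 / 2 * ((l2norm x)\<^sup>2 + (l2norm x)\<^sup>2))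
        + (- \<mu>) * (S + (- 1) * S) + (- \<gamma>) * (l2norm x)\<^sup>2 + c1_const k p g)"
    by (rule has_sum_mono[OF hX])
  then show ?thesis
    by (simp add: algebra_simps)
qed

lemma c1_const_nonneg: "0 < p \<Longrightarrow> 0 \<le> c1_const k p g"
  by (simp add: c1_const_def)

text \<open>
  \<open>(r\<^sup>*)\<^sup>2\<close> is at least \<open>c\<^sub>1/(\<gamma> - 4\<lambda>)\<close>, the fixed point of the affine recursion for the squared
  norm in \<open>implicit_step_energy\<close>; hence one step cannot leave the ball.
\<close>

lemma implicit_step_in_ball:
  fixes x w g :: "int \<Rightarrow> complex"
  assumes pos: "0 < l" "0 < k" "0 < p" "0 < \<epsilon>" "4 * l < \<gamma>" "0 \<le> \<eta>"
    and g: "g \<in> ellq ((p + 2) / (p + 1))"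
    and x: "x \<in> ell2" and w: "w \<in> Bl2 (r_star l \<gamma> k p g \<eta>)"
    and eq: "\<And>j. x j = w j + of_real \<epsilon> * F l \<mu> \<gamma> \<beta> k \<nu> p g x j"
  shows "x \<in> Bl2 (r_star l \<gamma> k p g \<eta>)"
proof -
  define r where "r = r_star l \<gamma> k p g \<eta>"
  define c where "c = c1_const k p g"
  have "0 \<le> c / (\<gamma> - 4 * l)"
    using pos c1_const_nonneg[of p k g] by (simp add: c_def)
  then have r2: "r\<^sup>2 = \<eta> + c / (\<gamma> - 4 * l)" and r: "0 \<le> r"
    using pos by (auto simp: r_def r_star_def c_def)
  have "(\<gamma> - 4 * l) * r\<^sup>2 = (\<gamma> - 4 * l) * \<eta> + c"
    using pos unfolding r2 by (simp add: distrib_left)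
  then have cr: "c \<le> (\<gamma> - 4 * l) * r\<^sup>2"
    using pos by simp
  have "(1 + 2 * \<epsilon> * (\<gamma> - 4 * l)) * (l2norm x)\<^sup>2 \<le> (l2norm w)\<^sup>2 + 2 * \<epsilon> * c"
    unfolding c_def using pos(1-4) g x Bl2_imp_ell2[OF w] eq by (rule implicit_step_energy)
  also have "\<dots> \<le> r\<^sup>2 + 2 * \<epsilon> * ((\<gamma> - 4 * l) * r\<^sup>2)"
    using w l2norm_nonneg[of w] pos cr
    by (intro add_mono power_mono mult_left_mono) (auto simp: Bl2_def r_def)
  also have "\<dots> = (1 + 2 * \<epsilon> * (\<gamma> - 4 * l)) * r\<^sup>2"
    by (simp add: algebra_simps)
  finally have "(l2norm x)\<^sup>2 \<le> r\<^sup>2"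
    by (rule mult_left_le_imp_le) (use pos in \<open>simp add: add_pos_pos\<close>)
  then have "l2norm x \<le> r"
    using r by (rule power2_le_imp_le)
  then show ?thesis
    using x by (simp add: Bl2_def r_def)
qed

section \<open>Solvability of one step\<close>

text \<open>
  Enlarging the radius by one serves two purposes: it leaves room for the displacement
  \<open>\<epsilon> F u\<close>, whose norm is at most one, and it keeps the radius positive.
\<close>

lemma implicit_step_contraction:
  assumes pos: "0 < l" "0 < \<gamma>" "0 < k" "0 < p" "0 < \<epsilon>" "0 \<le> r"
    and C: "is_lipschitz_const p C"
    and small: "\<epsilon> * L_const l \<mu> \<gamma> \<beta> k \<nu> p C (r + 1) \<le> q"
    and u: "u \<in> Bl2 (r + 1)" and v: "v \<in> Bl2 (r + 1)" and d: "(\<lambda>j. u j - v j) \<in> Bl2 d"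
  shows "(\<lambda>j. (w j + of_real \<epsilon> * F l \<mu> \<gamma> \<beta> k \<nu> p g u j)
      - (w j + of_real \<epsilon> * F l \<mu> \<gamma> \<beta> k \<nu> p g v j)) \<in> Bl2 (q * d)"
proof -
  have "(\<lambda>j. F l \<mu> \<gamma> \<beta> k \<nu> p g u j - F l \<mu> \<gamma> \<beta> k \<nu> p g v j)
      \<in> Bl2 (L_const l \<mu> \<gamma> \<beta> k \<nu> p C (r + 1) * d)"
    using pos by (intro F_diff_in_Bl2 C u v d) auto
  then have "(\<lambda>j. of_real \<epsilon> * (F l \<mu> \<gamma> \<beta> k \<nu> p g u j - F l \<mu> \<gamma> \<beta> k \<nu> p g v j))
      \<in> Bl2 (\<epsilon> * (L_const l \<mu> \<gamma> \<beta> k \<nu> p C (r + 1) * d))"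
    using pos by (intro Bl2_scale) auto
  moreover have "\<epsilon> * (L_const l \<mu> \<gamma> \<beta> k \<nu> p C (r + 1) * d) \<le> q * d"
    using mult_right_mono[OF small Bl2_radius_nonneg[OF d]] by (simp only: mult.assoc)
  ultimately have "(\<lambda>j. of_real \<epsilon> * (F l \<mu> \<gamma> \<beta> k \<nu> p g u j - F l \<mu> \<gamma> \<beta> k \<nu> p g v j))
      \<in> Bl2 (q * d)"
    by (rule Bl2_mono)
  then show ?thesis
    by (simp only: add_diff_cancel_left right_diff_distrib)
qed

lemma implicit_step_exists:
  assumes pos: "0 < l" "0 < \<gamma>" "0 < k" "0 < p" "0 < \<epsilon>" "0 \<le> r"
    and C: "is_lipschitz_const p C" and g: "g \<in> ell2"
    and M: "\<epsilon> * M_const l \<mu> \<gamma> \<beta> k \<nu> p g (r + 1) \<le> 1"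
    and L: "\<epsilon> * L_const l \<mu> \<gamma> \<beta> k \<nu> p C (r + 1) < 1"
    and w: "w \<in> Bl2 r"
  shows "\<exists>x\<in>Bl2 (r + 1). \<forall>j. x j = w j + of_real \<epsilon> * F l \<mu> \<gamma> \<beta> k \<nu> p g x j"
proof -
  define G where "G u = (\<lambda>j. w j + of_real \<epsilon> * F l \<mu> \<gamma> \<beta> k \<nu> p g u j)" for u
  have "\<exists>x\<in>Bl2 (r + 1). G x = x"
  proof (rule Bl2_contraction_fixed_point)
    show "0 \<le> r + 1"
      using pos by simp
    show "0 \<le> \<epsilon> * L_const l \<mu> \<gamma> \<beta> k \<nu> p C (r + 1)"
      using pos C by (simp add: L_const_def is_lipschitz_const_def)
    show "\<epsilon> * L_const l \<mu> \<gamma> \<beta> k \<nu> p C (r + 1) < 1"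
      by (rule L)
  next
    fix u assume "u \<in> Bl2 (r + 1)"
    then have "(\<lambda>j. of_real \<epsilon> * F l \<mu> \<gamma> \<beta> k \<nu> p g u j)
        \<in> Bl2 (\<epsilon> * M_const l \<mu> \<gamma> \<beta> k \<nu> p g (r + 1))"
      using pos g by (intro Bl2_scale F_in_Bl2) auto
    then show "G u \<in> Bl2 (r + 1)"
      unfolding G_def by (intro Bl2_add[OF w] Bl2_mono[OF _ M])
  next
    fix u v d assume "u \<in> Bl2 (r + 1)" "v \<in> Bl2 (r + 1)" "(\<lambda>j. u j - v j) \<in> Bl2 d"
    then show "(\<lambda>j. G u j - G v j) \<in> Bl2 (\<epsilon> * L_const l \<mu> \<gamma> \<beta> k \<nu> p C (r + 1) * d)"
      unfolding G_def by (rule implicit_step_contraction[OF pos C order_refl])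
  next
    fix X :: "nat \<Rightarrow> int \<Rightarrow> complex" and x j assume "\<And>i. (\<lambda>n. X n i) \<longlonglongrightarrow> x i"
    then show "(\<lambda>n. G (X n) j) \<longlonglongrightarrow> G x j"
      unfolding G_def using pos by (intro tendsto_intros F_pointwise_continuous)
  qed
  then obtain x where x: "x \<in> Bl2 (r + 1)" "G x = x"
    by blast
  show ?thesis
  proof (intro bexI allI)
    show "x j = w j + of_real \<epsilon> * F l \<mu> \<gamma> \<beta> k \<nu> p g x j" for j
      using fun_cong[OF x(2), of j] unfolding G_def by (rule sym)
  qed (rule x(1))
qed

lemma implicit_step_unique:
  assumes pos: "0 < l" "0 < \<gamma>" "0 < k" "0 < p" "0 < \<epsilon>" "0 \<le> r"
    and C: "is_lipschitz_const p C"
    and L: "\<epsilon> * L_const l \<mu> \<gamma> \<beta> k \<nu> p C (r + 1) < 1"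
    and x: "x \<in> Bl2 (r + 1)" "\<And>j. x j = w j + of_real \<epsilon> * F l \<mu> \<gamma> \<beta> k \<nu> p g x j"
    and y: "y \<in> Bl2 (r + 1)" "\<And>j. y j = w j + of_real \<epsilon> * F l \<mu> \<gamma> \<beta> k \<nu> p g y j"
  shows "x = y"
proof (rule Bl2_contraction_fixed_point_unique[OF L])
  fix u v d assume "u \<in> Bl2 (r + 1)" "v \<in> Bl2 (r + 1)" "(\<lambda>j. u j - v j) \<in> Bl2 d"
  then show "(\<lambda>j. (w j + of_real \<epsilon> * F l \<mu> \<gamma> \<beta> k \<nu> p g u j)
      - (w j + of_real \<epsilon> * F l \<mu> \<gamma> \<beta> k \<nu> p g v j))
      \<in> Bl2 (\<epsilon> * L_const l \<mu> \<gamma> \<beta> k \<nu> p C (r + 1) * d)"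
    by (rule implicit_step_contraction[OF pos C order_refl])
next
  show "(\<lambda>j. w j + of_real \<epsilon> * F l \<mu> \<gamma> \<beta> k \<nu> p g x j) = x"
    by (rule ext) (rule x(2)[symmetric])
  show "(\<lambda>j. w j + of_real \<epsilon> * F l \<mu> \<gamma> \<beta> k \<nu> p g y j) = y"
    by (rule ext) (rule y(2)[symmetric])
qed (rule x(1) y(1))+

section \<open>Iterating the step\<close>

text \<open>
  Invariance is assumed for every solution of a step, not just for one; this is what gives
  uniqueness among all sequences in \<open>\<ell>\<^sup>2\<close>.
\<close>

lemma euler_solution_iterate:
  assumes exists: "\<And>w. w \<in> B \<Longrightarrow> \<exists>x\<in>ell2. \<forall>j. x j = w j + of_real \<epsilon> * f x j"
    and unique: "\<And>w x y. \<lbrakk>w \<in> B; x \<in> B; y \<in> B; \<And>j. x j = w j + of_real \<epsilon> * f x j;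
      \<And>j. y j = w j + of_real \<epsilon> * f y j\<rbrakk> \<Longrightarrow> x = y"
    and invariant: "\<And>w x. \<lbrakk>w \<in> B; x \<in> ell2; \<And>j. x j = w j + of_real \<epsilon> * f x j\<rbrakk> \<Longrightarrow> x \<in> B"
    and B: "B \<subseteq> ell2" "u0 \<in> B"
  shows "(\<exists>!U. euler_solution f \<epsilon> u0 U) \<and> (\<forall>U. euler_solution f \<epsilon> u0 U \<longrightarrow> (\<forall>n. U n \<in> B))"
proof -
  have rec: "euler_solution f \<epsilon> u0 U \<longleftrightarrow> (\<forall>n. U n \<in> ell2) \<and> U 0 = u0 \<and>
      (\<forall>n j. U (Suc n) j = U n j + of_real \<epsilon> * f (U (Suc n)) j)" for U
    unfolding euler_solution_def
    by (metis One_nat_def Suc_le_D diff_Suc_1 le_add1 plus_1_eq_Suc)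
  have inB: "U n \<in> B" if U: "euler_solution f \<epsilon> u0 U" for U n
  proof (induction n)
    case 0
    then show ?case
      using U B by (simp add: rec)
  next
    case (Suc n)
    show ?case
      by (rule invariant[OF Suc]) (use U in \<open>unfold rec, blast+\<close>)
  qed
  have "\<exists>U. \<forall>n. (U n \<in> B \<and> (n = 0 \<longrightarrow> U n = u0)) \<and>
      (\<forall>j. U (Suc n) j = U n j + of_real \<epsilon> * f (U (Suc n)) j)"
  proof (rule dependent_nat_choice)
    show "\<exists>x. x \<in> B \<and> (0 = (0::nat) \<longrightarrow> x = u0)"
      using B by auto
    fix w and n :: nat assume "w \<in> B \<and> (n = 0 \<longrightarrow> w = u0)"
    then show "\<exists>y. (y \<in> B \<and> (Suc n = 0 \<longrightarrow> y = u0)) \<and> (\<forall>j. y j = w j + of_real \<epsilon> * f y j)"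
      using exists[of w] invariant[of w] by blast
  qed
  then obtain U where U: "\<forall>n. (U n \<in> B \<and> (n = 0 \<longrightarrow> U n = u0)) \<and>
      (\<forall>j. U (Suc n) j = U n j + of_real \<epsilon> * f (U (Suc n)) j)"
    by (rule exE)
  have "euler_solution f \<epsilon> u0 U"
    unfolding rec
  proof (intro conjI allI)
    fix n j
    show "U n \<in> ell2" "U 0 = u0"
      using B(1) spec[OF U, of n] spec[OF U, of 0] by auto
    show "U (Suc n) j = U n j + of_real \<epsilon> * f (U (Suc n)) j"
      using spec[OF U, of n] by blast
  qed
  moreover have "U = V" if U: "euler_solution f \<epsilon> u0 U" and V: "euler_solution f \<epsilon> u0 V" for U V
  proof
    fix n show "U n = V n"
    proof (induction n)
      case 0
      then show ?case
        using U V by (simp add: rec)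
    next
      case (Suc n)
      show ?case
      proof (rule unique[of "U n", OF inB[OF U] inB[OF U] inB[OF V]])
        show "U (Suc n) j = U n j + of_real \<epsilon> * f (U (Suc n)) j" for j
          using U unfolding rec by blast
        show "V (Suc n) j = U n j + of_real \<epsilon> * f (V (Suc n)) j" for j
          using V unfolding rec Suc by blast
      qed
    qed
  qed
  ultimately show ?thesis
    using inB by blast
qed

theorem theorem2p1:
  fixes l \<mu> \<gamma> \<beta> k \<nu> p C \<eta> \<epsilon> :: real
    and g u0 :: "int \<Rightarrow> complex"
  assumes "l > 0" and "\<gamma> > 0" and "k > 0" and "p > 0"
    and "\<gamma> > 4 * l"
    and "g \<in> ellq ((p + 2) / (p + 1))"
    and "is_lipschitz_const p C"
    and "\<eta> \<ge> 0"
    and "0 < \<epsilon>" and "\<epsilon> \<le> eps_star l \<mu> \<gamma> \<beta> k \<nu> p g C \<eta>"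
    and "u0 \<in> Bl2 (r_star l \<gamma> k p g \<eta>)"
  shows "(\<exists>!U. euler_solution (F l \<mu> \<gamma> \<beta> k \<nu> p g) \<epsilon> u0 U) \<and>
         (\<forall>U. euler_solution (F l \<mu> \<gamma> \<beta> k \<nu> p g) \<epsilon> u0 U \<longrightarrow>
              (\<forall>n. U n \<in> Bl2 (r_star l \<gamma> k p g \<eta>)))"
proof (rule euler_solution_iterate)
  define r where "r = r_star l \<gamma> k p g \<eta>"
  have r: "0 \<le> r"
    using assms(11) Bl2_radius_nonneg by (auto simp: r_def)
  have g2: "g \<in> ell2"
    using ellq_subset_ell2[of "(p + 2) / (p + 1)"] assms(4,6) by (auto simp: field_simps)
  have "0 < (4 * l + 4 * \<bar>\<mu>\<bar> + \<gamma> + \<bar>\<beta>\<bar>) * (r + 1)"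
    using assms(1,2) r by (intro mult_pos_pos) auto
  then have "0 < M_const l \<mu> \<gamma> \<beta> k \<nu> p g (r + 1)"
    unfolding M_const_def using assms(3) l2norm_nonneg[of g]
    by (simp add: add_pos_nonneg)
  then have M: "\<epsilon> * M_const l \<mu> \<gamma> \<beta> k \<nu> p g (r + 1) \<le> 1"
    using assms(10) by (simp add: eps_star_def r_def field_simps)
  have "0 < L_const l \<mu> \<gamma> \<beta> k \<nu> p C (r + 1)"
    unfolding L_const_def using assms(1-4,7)
    by (intro add_pos_nonneg) (auto simp: is_lipschitz_const_def)
  then have "\<epsilon> * (1 + L_const l \<mu> \<gamma> \<beta> k \<nu> p C (r + 1)) \<le> 1"
    using assms(10) by (simp add: eps_star_def r_def field_simps)
  then have L: "\<epsilon> * L_const l \<mu> \<gamma> \<beta> k \<nu> p C (r + 1) < 1"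
    using assms(9) by (simp add: distrib_left)
  {
    fix w assume w: "w \<in> Bl2 (r_star l \<gamma> k p g \<eta>)"
    show "\<exists>x\<in>ell2. \<forall>j. x j = w j + of_real \<epsilon> * F l \<mu> \<gamma> \<beta> k \<nu> p g x j"
      using implicit_step_exists[OF assms(1-4,9) r assms(7) g2 M L] w Bl2_imp_ell2
      by (fold r_def) blast
    fix x
    {
      fix y assume "x \<in> Bl2 (r_star l \<gamma> k p g \<eta>)" "y \<in> Bl2 (r_star l \<gamma> k p g \<eta>)"
        and eqs: "\<And>j. x j = w j + of_real \<epsilon> * F l \<mu> \<gamma> \<beta> k \<nu> p g x j"
          "\<And>j. y j = w j + of_real \<epsilon> * F l \<mu> \<gamma> \<beta> k \<nu> p g y j"
      then have "x \<in> Bl2 (r + 1)" "y \<in> Bl2 (r + 1)"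
        by (auto simp: r_def intro: Bl2_mono)
      then show "x = y"
        by (rule implicit_step_unique[OF assms(1-4,9) r assms(7) L, OF _ eqs(1) _ eqs(2)])
    }
    assume "x \<in> ell2" "\<And>j. x j = w j + of_real \<epsilon> * F l \<mu> \<gamma> \<beta> k \<nu> p g x j"
    from this(1) w this(2) show "x \<in> Bl2 (r_star l \<gamma> k p g \<eta>)"
      by (rule implicit_step_in_ball[OF assms(1,3,4,9,5,8,6)])
  }
  show "Bl2 (r_star l \<gamma> k p g \<eta>) \<subseteq> ell2"
    using Bl2_imp_ell2 by blast
  show "u0 \<in> Bl2 (r_star l \<gamma> k p g \<eta>)"
    by (rule assms(11))
qed

end
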